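(* For $n\ge0$ let ${}^{\ell}B_n(q,Y_0,Y_1,Z)$ be defined by the identity of formal power series in $u$ $$\sum_{n\ge 0}\frac{u^n}{(-Zq;q)_n\,(q;q)_n}\,{}^{\ell}B_n(q,Y_0,Y_1,Z)=\Bigl(1-\frac{u}{1-q}\Bigr)^{-1}(u;q)_\infty\Bigl(\sum_{n\ge 0}\frac{(-qY_0^{-1}Y_1Z;q)_n\,(uY_0)^n}{(-Zq;q)_n\,(q;q)_n}\Bigr).$$ Then for every $n\ge0$, $${}^{\ell}B_n(q,Y_0,Y_1,Z)=\sum_{w\in B_n}q^{\ell(w)}\,Y_0^{\mathrm{pix}^+w}\,Y_1^{\mathrm{pix}^-w}\,Z^{\mathrm{neg}\,w}.$$
   Context: $(a;q)_0=1$, $(a;q)_n=(1-a)(1-aq)\cdots(1-aq^{n-1})$ for $n\ge1$, and $(a;q)_\infty=\prod_{n\ge1}(1-aq^{n-1})$. $B_n$ is the set of signed permutations of order $n$: words $w=x_1\cdots x_n$ with $x_i\in\{-n,\dots,-1,1,\dots,n\}$ and $|x_1|\cdots|x_n|$ a permutation of $12\cdots n$. $\mathrm{neg}\,w$ is the number of negative letters of $w$. The length of $w$ is $\ell(w)=\mathrm{inv}\,w+\sum_{i:\,x_i<0}|x_i|$, where $\mathrm{inv}\,w=\#\{(i,j):1\le i<j\le n,\ x_i>x_j\}$ (this is the Coxeter length function of $B_n$). A word $x_1\cdots x_m$ of distinct integers is a desarrangement if there is $k\ge1$ with $x_1>x_2>\cdots>x_{2k}$ and $x_{2k}<x_{2k+1}$,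 with convention $x_{m+1}=\infty$; the empty word is also a desarrangement. Every $w\in B_n$ has a unique factorization $w=w^-w^+w^d$ where $w^d$ is the longest right factor of $w$ that is a desarrangement, $w^-$ is an increasing word of negative letters and $w^+$ an increasing word of positive letters; $\mathrm{pix}^-w$ and $\mathrm{pix}^+w$ are the lengths of $w^-$ and $w^+$. *)

theory Defs
  imports
    "HOL-Computational_Algebra.Computational_Algebra"
    "HOL-Combinatorics.Multiset_Permutations"
    "HOL-Library.Sublist"
begin

section \<open>The ring of coefficients\<close>

text \<open>
  The identity is one of formal objects: \<open>Y0\<close>, \<open>Y1\<close>, \<open>Z\<close> are indeterminates, adjoined to the
  integers innermost to outermost; since \<open>Y0\<close> gets inverted, we pass to the field of rational
  functions.  The denominators \<open>1 - q\<close>, \<open>(q;q)_n\<close> and \<open>(-Zq;q)_n\<close> have constant term 1 as power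
  series in \<open>q\<close> over this field, so they are units in \<open>qseries\<close>.  The outer indeterminate \<open>u\<close> is
  \<open>fps_X :: qseries fps\<close>.
\<close>

type_synonym qseries = "int poly poly poly fract fps"

definition var_q :: qseries where
  "var_q = fps_X"

definition var_Y0 :: qseries where
  "var_Y0 = fps_const (to_fract [:[:[:0, 1:]:]:])"

definition var_Y1 :: qseries where
  "var_Y1 = fps_const (to_fract [:[:0, 1:]:])"

definition var_Z :: qseries where
  "var_Z = fps_const (to_fract [:0, 1:])"

definition qpoch :: "'a :: comm_ring_1 \<Rightarrow> 'a \<Rightarrow> nat \<Rightarrow> 'a" where
  "qpoch a q n = (\<Prod>i<n. 1 - a * q ^ i)"

text \<open>
  The infinite product does not converge in the metric of \<open>qseries fps\<close>, which is the \<open>u\<close>-adic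
  one.  It converges coefficientwise with respect to the \<open>q\<close>-adic metric of \<open>qseries\<close>;
  see \<open>qpoch_inf_convergent\<close> below.
\<close>

definition qpoch_inf :: "qseries fps \<Rightarrow> qseries fps \<Rightarrow> qseries fps" where
  "qpoch_inf a q = Abs_fps (\<lambda>m. lim (\<lambda>N. fps_nth (qpoch a q N) m))"

lemma qpoch_inf_convergent:
  "convergent (\<lambda>N. fps_nth (qpoch a (fps_const var_q) N) m)"
proof -
  define P where "P N = fps_nth (qpoch a (fps_const var_q) N) m" for N
  have P_Suc: "P (Suc N) = P N - fps_nth (qpoch a (fps_const var_q) N * a) m * fps_X ^ N" for N
  proof -
    let ?P = "qpoch a (fps_const var_q) N"
    have "qpoch a (fps_const var_q) (Suc N) = ?P - (?P * a) * fps_const (fps_X ^ N)"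
      by (simp add: qpoch_def var_q_def right_diff_distrib mult.assoc)
    then show ?thesis
      by (simp only: P_def fps_sub_nth fps_mult_right_const_nth)
  qed
  have eq: "fps_nth (P N) k = fps_nth (P (Suc k)) k" if "N \<ge> Suc k" for N k
    using that
  proof (induction N rule: dec_induct)
    case base
    then show ?case by simp
  next
    case (step n)
    then show ?case
      by (simp add: P_Suc [of n] fps_X_power_mult_right_nth)
  qed
  have "P \<longlonglongrightarrow> Abs_fps (\<lambda>k. fps_nth (P (Suc k)) k)"
    unfolding tendsto_fps_iff
  proof
    fix k
    show "\<forall>\<^sub>F N in sequentially.
        fps_nth (P N) k = fps_nth (Abs_fps (\<lambda>k. fps_nth (P (Suc k)) k)) k"
      using eventually_ge_at_top[of "Suc k"] by eventually_elim (simp, rule eq)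
  qed
  then show ?thesis
    by (auto simp: convergent_def P_def [abs_def])
qed

lemma qpoch_constant_term: "fps_nth (qpoch (b * var_q) var_q n) 0 = 1"
  by (induction n) (simp_all add: qpoch_def var_q_def)


text \<open>Consequently the generating function identity determines its coefficients.\<close>

lemma generating_function_ex1:
  "\<exists>!B. Abs_fps (\<lambda>n. B n / (qpoch (- var_Z * var_q) var_q n * qpoch var_q var_q n)) = F"
proof -
  define D where "D n = qpoch (- var_Z * var_q) var_q n * qpoch var_q var_q n" for n
  have "fps_nth (D n) 0 = 1" for n
    using qpoch_constant_term[of "- var_Z" n] qpoch_constant_term[of 1 n]
    by (simp add: D_def)
  then have D: "c / D n = c * inverse (D n)" "inverse (D n) * D n = 1" for c n
    by (simp_all add: fps_divide_unit inverse_mult_eq_1)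
  have "Abs_fps (\<lambda>n. B n / D n) = F \<longleftrightarrow> B = (\<lambda>n. fps_nth F n * D n)" for B
  proof -
    have "B n / D n * D n = B n" "c * D n / D n = c" for n c
      using D(2)[of n] by (simp_all add: D(1) mult.assoc mult.commute[of "D n"])
    then have "B n / D n = fps_nth F n \<longleftrightarrow> B n = fps_nth F n * D n" for n
      by metis
    then show ?thesis
      by (simp add: fun_eq_iff fps_eq_iff [where 'a = qseries])
  qed
  then show ?thesis
    unfolding D_def by auto
qed


section \<open>Signed permutations and their statistics\<close>

definition signed_perms :: "nat \<Rightarrow> int list set" where
  "signed_perms n =
     {w. set w \<subseteq> {- int n..int n} - {0} \<and> map abs w \<in> permutations_of_set {1..int n}}"

definition neg :: "int list \<Rightarrow> nat" where
  "neg w = length (filter (\<lambda>x. x < 0) w)"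

definition inv_num :: "int list \<Rightarrow> nat" where
  "inv_num w = card {(i, j). i < j \<and> j < length w \<and> w ! i > w ! j}"

definition coxeter_length :: "int list \<Rightarrow> nat" where
  "coxeter_length w = inv_num w + (\<Sum>i | i < length w \<and> w ! i < 0. nat \<bar>w ! i\<bar>)"

text \<open>
  Positions are counted from 0, so the letter \<open>x_(2k)\<close> is \<open>xs ! (2 * k - 1)\<close>; the convention
  \<open>x_(m+1) = \<infinity>\<close> is the disjunct \<open>2 * k = length xs\<close>.
\<close>

definition desarrangement :: "int list \<Rightarrow> bool" where
  "desarrangement xs \<longleftrightarrow> distinct xs \<and>
     (xs = [] \<or>
      (\<exists>k\<ge>1. 2 * k \<le> length xs \<and>
         (\<forall>i. i + 1 < 2 * k \<longrightarrow> xs ! i > xs ! (i + 1)) \<and>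
         (2 * k = length xs \<or> xs ! (2 * k - 1) < xs ! (2 * k))))"

definition pixed_factorization :: "int list \<Rightarrow> int list \<times> int list \<times> int list \<Rightarrow> bool" where
  "pixed_factorization w = (\<lambda>(wm, wp, wd).
     w = wm @ wp @ wd \<and>
     desarrangement wd \<and> (\<forall>v. suffix v w \<and> desarrangement v \<longrightarrow> length v \<le> length wd) \<and>
     sorted_wrt (<) wm \<and> (\<forall>x\<in>set wm. x < 0) \<and>
     sorted_wrt (<) wp \<and> (\<forall>x\<in>set wp. x > 0))"

definition pix_minus :: "int list \<Rightarrow> nat" where
  "pix_minus w = (case (THE f. pixed_factorization w f) of (wm, wp, wd) \<Rightarrow> length wm)"

definition pix_plus :: "int list \<Rightarrow> nat" where
  "pix_plus w = (case (THE f. pixed_factorization w f) of (wm, wp, wd) \<Rightarrow> length wp)"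

lemma desarrangement_cons2:
  assumes "distinct (x # y # d)" "x > y"
    and "d = [] \<or> y < hd d \<or> desarrangement d"
  shows "desarrangement (x # y # d)"
proof -
  consider "d = []" | "d \<noteq> []" "y < hd d" | "d \<noteq> []" "y \<ge> hd d" "desarrangement d"
    using assms(3) by fastforce
  then show ?thesis
  proof cases
    case 3
    then obtain k where k: "k \<ge> 1" "2 * k \<le> length d"
        "\<And>i. i + 1 < 2 * k \<Longrightarrow> d ! i > d ! (i + 1)"
        "2 * k = length d \<or> d ! (2 * k - 1) < d ! (2 * k)"
      by (auto simp: desarrangement_def)
    have "y > d ! 0"
      using 3 assms(1) by (cases d) auto
    then have "(x # y # d) ! i > (x # y # d) ! (i + 1)" if "i + 1 < 2 * (k + 1)" for i
      using k(3)[of "i - 2"] that assms(2)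
      by (auto simp: nth_Cons split: nat.splits)
    moreover have "2 * (k + 1) = length (x # y # d) \<or>
        (x # y # d) ! (2 * (k + 1) - 1) < (x # y # d) ! (2 * (k + 1))"
      using k(1,4) by (auto simp: nth_Cons split: nat.splits)
    moreover have "k + 1 \<ge> 1" "2 * (k + 1) \<le> length (x # y # d)"
      using k(2) by auto
    ultimately show ?thesis
      using assms(1) unfolding desarrangement_def by blast
  qed (use assms in \<open>auto simp: desarrangement_def hd_conv_nth intro!: exI[of _ 1]\<close>)
qed

lemma longest_desarrangement_suffix:
  assumes "distinct w"
  shows "\<exists>p d. w = p @ d \<and> sorted_wrt (<) p \<and> desarrangement d \<and>
           (\<forall>v. suffix v w \<and> desarrangement v \<longrightarrow> length v \<le> length d)"
  using assms
proof (induction w)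
  case Nil
  show ?case by (auto simp: desarrangement_def)
next
  case (Cons x w)
  then obtain p d where pd: "w = p @ d" "sorted_wrt (<) p" "desarrangement d"
      "\<And>v. suffix v w \<Longrightarrow> desarrangement v \<Longrightarrow> length v \<le> length d"
    by auto
  show ?case
  proof (cases "desarrangement (x # w)")
    case True
    then show ?thesis
      by (intro exI[of _ "[]"] exI[of _ "x # w"]) (auto dest: suffix_length_le)
  next
    case False
    have "sorted_wrt (<) (x # p)"
    proof (cases p)
      case p: (Cons y p')
      have "x < y"
      proof (rule ccontr)
        assume "\<not> x < y"
        then have "x > y"
          using Cons.prems pd p by auto
        moreover have "p' @ d = [] \<or> y < hd (p' @ d) \<or> desarrangement (p' @ d)"
          using pd(2,3) p by (cases p') auto
        ultimately show False
          using desarrangement_cons2[of x y "p' @ d"] False Cons.prems pd(1) p by auto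
      qed
      then show ?thesis
        using pd(2) p by fastforce
    qed simp
    moreover have "length v \<le> length d" if "suffix v (x # w)" "desarrangement v" for v
      using that False pd(4) by (auto simp: suffix_Cons)
    ultimately show ?thesis
      using pd by (intro exI[of _ "x # p"] exI[of _ d]) auto
  qed
qed

lemma pixed_factorization_ex1:
  assumes "w \<in> signed_perms n"
  shows "\<exists>!f. pixed_factorization w f"
proof -
  have "distinct (map abs w)" and nz: "0 \<notin> set w"
    using assms by (auto simp: signed_perms_def permutations_of_set_def)
  then have "distinct w"
    by (simp add: distinct_map)
  then obtain p d where pd: "w = p @ d" "sorted_wrt (<) p" "desarrangement d"
      "\<And>v. suffix v w \<Longrightarrow> desarrangement v \<Longrightarrow> length v \<le> length d"
    using longest_desarrangement_suffix by blast
  have split: "p = filter (\<lambda>x. x < 0) p @ filter (\<lambda>x. x > 0) p"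
    if "sorted_wrt (<) p" "0 \<notin> set p" for p :: "int list"
    using that
  proof (induction p)
    case (Cons x p)
    then have "filter (\<lambda>x. x < 0) p = []" if "x > 0"
      using that by (auto simp: filter_empty_conv)
    with Cons show ?case by (cases "x < 0") auto
  qed simp
  show ?thesis
  proof (rule ex1I)
    have "w = filter (\<lambda>x. x < 0) p @ filter (\<lambda>x. x > 0) p @ d"
      using split[OF pd(2)] nz pd(1) by auto
    then show "pixed_factorization w (filter (\<lambda>x. x < 0) p, filter (\<lambda>x. x > 0) p, d)"
      using pd by (auto simp: pixed_factorization_def intro: sorted_wrt_filter)
  next
    fix f assume f: "pixed_factorization w f"
    obtain wm wp wd where [simp]: "f = (wm, wp, wd)"
      by (cases f)
    from f have w: "w = wm @ wp @ wd" "desarrangement wd"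
        "\<And>v. suffix v w \<Longrightarrow> desarrangement v \<Longrightarrow> length v \<le> length wd"
        and sgn: "\<forall>x\<in>set wm. x < 0" "\<forall>x\<in>set wp. x > 0"
      by (auto simp: pixed_factorization_def)
    have "suffix d w" "suffix wd w"
      by (rule suffixI[OF pd(1)], rule suffixI[of _ "wm @ wp"]) (simp add: w(1))
    then have "length d = length wd"
      using pd(3,4) w(2,3) by (simp add: le_antisym)
    then have "wd = d" "wm @ wp = p"
      using pd(1) w(1) append_eq_append_conv[of "wm @ wp" p wd d] by auto
    moreover have "filter (\<lambda>x. x < 0) (wm @ wp) = wm" "filter (\<lambda>x. x > 0) (wm @ wp) = wp"
      using sgn by (fastforce simp: filter_id_conv filter_empty_conv)+
    ultimately show "f = (filter (\<lambda>x. x < 0) p, filter (\<lambda>x. x > 0) p, d)"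
      by auto
  qed
qed

end

theory Submission
  imports Defs
begin

text \<open>
  A word is an increasing word \<open>p\<close> followed by a desarrangement \<open>d\<close> in exactly one way, and then
  \<open>d\<close> is the longest desarrangement suffix.  Fixing the set of letters \<open>L\<close> and the subset \<open>P\<close> of
  letters of \<open>p\<close>, the length splits into a part depending on \<open>P\<close> and \<open>L - P\<close> only and \<open>inv d\<close>; the
  sum of \<open>q ^ inv d\<close> over the desarrangements of \<open>L - P\<close> is a polynomial \<open>D\<^sub>m(q)\<close> depending only on
  \<open>m = card (L - P)\<close>.  The sum over \<open>L\<close> and \<open>P\<close> is found by inserting the letters in the order of
  their absolute values: the new letter is positive or negative and goes to \<open>P\<close> or to \<open>L - P\<close>,
  which gives a Pascal-type recurrence with a closed product solution.  The unsigned case of the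
  same recurrence, together with Euler's expansion of \<open>1 / (u;q)\<^sub>\<infinity>\<close>, identifies the generating
  function of \<open>D\<^sub>m(q) / (q;q)\<^sub>m\<close> as \<open>(1 - u/(1-q))\<inverse> (u;q)\<^sub>\<infinity>\<close>.
\<close>

section \<open>Increasing words followed by desarrangements\<close>

text \<open>A parity argument. The initial decreasing run of a nonempty desarrangement has even
  length \<open>2 * k\<close>; prepending a letter either lengthens it to \<open>2 * k + 1\<close>
  or cuts it down to length 1.\<close>

lemma desarrangement_Cons_Not:
  assumes "desarrangement d"
  shows "\<not> desarrangement (x # d)"
proof
  assume "desarrangement (x # d)"
  then obtain j where j: "j \<ge> 1" "2 * j \<le> Suc (length d)"
      "\<And>i. i + 1 < 2 * j \<Longrightarrow> (x # d) ! i > (x # d) ! (i + 1)"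
      "2 * j = Suc (length d) \<or> (x # d) ! (2 * j - 1) < (x # d) ! (2 * j)"
    by (auto simp: desarrangement_def)
  then have "d \<noteq> []" by auto
  then obtain k where k: "k \<ge> 1" "2 * k \<le> length d"
      "\<And>i. i + 1 < 2 * k \<Longrightarrow> d ! i > d ! (i + 1)"
      "2 * k = length d \<or> d ! (2 * k - 1) < d ! (2 * k)"
    using assms by (auto simp: desarrangement_def)
  show False
  proof (cases "j \<le> k")
    \<comment> \<open>The ascent that ends the run of \<open>x # d\<close> would lie inside the
      decreasing run of \<open>d\<close>.\<close>
    case True
    then have "d ! (2 * j - 2) > d ! (2 * j - 1)"
      using k(3)[of "2 * j - 2"] j(1) by (simp add: eval_nat_numeral Suc_diff_Suc)
    moreover have "(x # d) ! (2 * j - 1) = d ! (2 * j - 2)" "(x # d) ! (2 * j) = d ! (2 * j - 1)"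
      using j(1) by (auto simp: nth_Cons' numeral_2_eq_2)
    ultimately show False
      using j(4) k(2) True by auto
  next
    \<comment> \<open>Here the ascent that ends the run of \<open>d\<close> would lie inside the
      decreasing run of \<open>x # d\<close>.\<close>
    case False
    then have "d ! (2 * k - 1) > d ! (2 * k)"
      using j(3)[of "2 * k"] k(1) by (simp add: nth_Cons')
    then show False
      using k(2,4) j(2) False by auto
  qed
qed

text \<open>One letter in front of \<open>d\<close> is excluded by parity; two or more begin with an
  ascent, whereas a nonempty desarrangement begins with a descent.\<close>

lemma desarrangement_append_increasing:
  assumes "sorted_wrt (<) p" "desarrangement d" "desarrangement (p @ d)"
  shows "p = []"
proof (cases p)
  case p: (Cons x p')
  show ?thesis
  proof (cases p')
    case Nil
    then show ?thesis
      using assms desarrangement_Cons_Not p by simp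
  next
    case (Cons y p'')
    have "x < y"
      using assms(1) p Cons by simp
    moreover from assms(3) obtain k where "k \<ge> 1"
        "\<forall>i. i + 1 < 2 * k \<longrightarrow> (p @ d) ! i > (p @ d) ! (i + 1)"
      using p by (auto simp: desarrangement_def)
    then have "x > y"
      using p Cons by (auto dest!: spec[of _ 0])
    ultimately show ?thesis by simp
  qed
qed simp

text \<open>A suffix reaching beyond \<open>d\<close> has the form \<open>p' @ d\<close> with
  \<open>p'\<close> increasing. Hence any such factorization already has the longest desarrangement
  suffix, which makes it unique.\<close>

lemma desarrangement_suffix_le:
  assumes "sorted_wrt (<) p" "desarrangement d" "suffix v (p @ d)" "desarrangement v"
  shows "length v \<le> length d"
proof -
  from assms(3) consider "suffix v d" | p' where "v = p' @ d" "suffix p' p"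
    by (auto simp: suffix_append)
  then show ?thesis
  proof cases
    case 2
    then have "sorted_wrt (<) p'"
      using assms(1) by (auto simp: suffix_def sorted_wrt_append)
    then show ?thesis
      using desarrangement_append_increasing assms 2 by fastforce
  qed (rule suffix_length_le)
qed

lemma increasing_desarrangement_unique:
  assumes "p @ d = p' @ d'"
    and "sorted_wrt (<) p" "desarrangement d" "sorted_wrt (<) p'" "desarrangement d'"
  shows "p = p' \<and> d = d'"
proof -
  have "suffix d (p' @ d')" "suffix d' (p @ d)"
    using assms(1) by (metis suffixI)+
  then have "length d = length d'"
    using desarrangement_suffix_le assms by (intro antisym) blast+
  with assms(1) show ?thesis by simp
qed

lemma sum_permutations_of_set_desarrangement:
  fixes g :: "int list \<Rightarrow> 'a :: comm_monoid_add"
  assumes "finite L"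
  shows "(\<Sum>w\<in>permutations_of_set L. g w) =
    (\<Sum>P\<in>Pow L. \<Sum>d | d \<in> permutations_of_set (L - P) \<and> desarrangement d.
       g (sorted_list_of_set P @ d))"
proof -
  \<comment> \<open>An increasing word is determined by its set of letters, so a factorization is
    recorded as a pair \<open>(P, d)\<close>.\<close>
  define S where "S = Sigma (Pow L) (\<lambda>P. {d \<in> permutations_of_set (L - P). desarrangement d})"
  define h where "h = (\<lambda>(P, d). sorted_list_of_set P @ d :: int list)"
  have fin: "finite P" if "P \<in> Pow L" for P
    using that assms by (auto intro: finite_subset)
  have "bij_betw h S (permutations_of_set L)"
  proof (rule bij_betwI')
    fix a b assume "a \<in> S" "b \<in> S"
    then show "(h a = h b) = (a = b)"
      using increasing_desarrangement_unique[of "sorted_list_of_set (fst a)" "snd a"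
              "sorted_list_of_set (fst b)" "snd b"] fin
        sorted_list_of_set_inject[of "fst a" "fst b"]
      by (auto simp: h_def S_def split: prod.splits)
  next
    fix a assume "a \<in> S"
    then show "h a \<in> permutations_of_set L"
      using fin by (fastforce simp: h_def S_def permutations_of_set_def)
  next
    fix w assume w: "w \<in> permutations_of_set L"
    then obtain p d where pd: "w = p @ d" "sorted_wrt (<) p" "desarrangement d"
      using longest_desarrangement_suffix[of w] by (auto simp: permutations_of_set_def)
    have "sorted_list_of_set (set p) = p"
      using pd(2) by (simp add: strict_sorted_iff sorted_list_of_set.idem_if_sorted_distinct)
    then show "\<exists>a\<in>S. w = h a"
      using w pd by (intro bexI[of _ "(set p, d)"])
        (auto simp: h_def S_def permutations_of_set_def)
  qed
  then have "(\<Sum>w\<in>permutations_of_set L. g w) = (\<Sum>a\<in>S. g (h a))"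
    by (simp add: sum.reindex_bij_betw)
  also have "\<dots> = (\<Sum>P\<in>Pow L. \<Sum>d | d \<in> permutations_of_set (L - P) \<and> desarrangement d.
       g (sorted_list_of_set P @ d))"
    unfolding S_def h_def using assms
    by (subst sum.Sigma) (auto simp: case_prod_unfold intro!: finite_subset[OF _ finite_permutations_of_set])
  finally show ?thesis .
qed

text \<open>In an increasing word the negative letters precede the positive ones, so splitting
  \<open>p\<close> by sign gives the two increasing factors. Both statistics thus depend on the
  letter set of \<open>p\<close> alone.\<close>

lemma pix_append:
  assumes "p @ d \<in> signed_perms n" "sorted_wrt (<) p" "desarrangement d"
  shows "pix_minus (p @ d) = card {x \<in> set p. x < 0}"
    and "pix_plus (p @ d) = card {x \<in> set p. x > 0}"
proof -
  have "0 \<notin> set p" "distinct p"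
    using assms(1,2) by (auto simp: signed_perms_def strict_sorted_iff)
  have "p = filter (\<lambda>x. x < 0) p @ filter (\<lambda>x. x > 0) p"
    using assms(2) \<open>0 \<notin> set p\<close>
  proof (induction p)
    case (Cons x p)
    then have "filter (\<lambda>x. x < 0) p = []" if "x > 0"
      using that by (auto simp: filter_empty_conv)
    with Cons show ?case by (cases "x < 0") auto
  qed simp
  then have "pixed_factorization (p @ d) (filter (\<lambda>x. x < 0) p, filter (\<lambda>x. x > 0) p, d)"
    using assms desarrangement_suffix_le[of p d]
    by (auto simp: pixed_factorization_def intro: sorted_wrt_filter)
  then have "(THE f. pixed_factorization (p @ d) f) =
      (filter (\<lambda>x. x < 0) p, filter (\<lambda>x. x > 0) p, d)"
    using pixed_factorization_ex1[OF assms(1)] by (simp add: the1_equality)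
  then show "pix_minus (p @ d) = card {x \<in> set p. x < 0}"
      "pix_plus (p @ d) = card {x \<in> set p. x > 0}"
    using \<open>distinct p\<close>
    by (simp_all add: pix_minus_def pix_plus_def flip: distinct_card)
qed

section \<open>Inversions\<close>

text \<open>Counts the inversions of a concatenation that straddle the cut; the order inside the two
  factors does not affect them.\<close>

definition cross :: "int set \<Rightarrow> int set \<Rightarrow> nat" where
  "cross P D = card {(x, y) \<in> P \<times> D. x > y}"

lemma inv_num_Nil [simp]: "inv_num [] = 0"
  by (simp add: inv_num_def)

lemma inv_num_Cons:
  assumes "distinct (x # xs)"
  shows "inv_num (x # xs) = card {y \<in> set xs. y < x} + inv_num xs"
proof -
  let ?I = "{(i, j). i < j \<and> j < length xs \<and> xs ! i > xs ! j}"
  have "{(i, j). i < j \<and> j < length (x # xs) \<and> (x # xs) ! i > (x # xs) ! j} =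
      (\<lambda>j. (0, Suc j)) ` {j. j < length xs \<and> xs ! j < x} \<union> map_prod Suc Suc ` ?I"
    (is "?J = ?A \<union> ?B")
  proof (intro set_eqI iffI)
    fix a assume "a \<in> ?J"
    then obtain i j where a: "a = (i, Suc j)" "i < Suc j" "j < length xs" "(x # xs) ! i > xs ! j"
      by (cases a; cases "snd a") auto
    then show "a \<in> ?A \<union> ?B"
      by (cases i) (auto intro!: image_eqI[of _ _ "(_, _)"])
  qed auto
  moreover have "finite ?I"
    by (rule finite_subset[of _ "{..<length xs} \<times> {..<length xs}"]) auto
  moreover have "?A \<inter> ?B = {}" by auto
  ultimately have "inv_num (x # xs) = card ?A + card ?B"
    unfolding inv_num_def by (simp add: card_Un_disjoint)
  also have "card ?B = inv_num xs"
    unfolding inv_num_def by (intro card_image) (auto simp: inj_on_def)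
  also have "card ?A = card {j. j < length xs \<and> xs ! j < x}"
    by (intro card_image) (auto simp: inj_on_def)
  also have "\<dots> = card {y \<in> set xs. y < x}"
    using assms
    by (intro bij_betw_same_card[of "(!) xs"])
      (auto simp: bij_betw_def inj_on_def nth_eq_iff_index_eq in_set_conv_nth)
  finally show ?thesis .
qed

lemma cross_insert_left:
  assumes "finite P" "finite D" "x \<notin> P"
  shows "cross (insert x P) D = card {y \<in> D. y < x} + cross P D"
proof -
  let ?I = "{(a, y) \<in> P \<times> D. a > y}"
  have "{(a, y) \<in> insert x P \<times> D. a > y} = Pair x ` {y \<in> D. y < x} \<union> ?I"
    by auto
  moreover have "finite ?I"
    using assms by (auto intro: finite_subset[of _ "P \<times> D"])
  moreover have "Pair x ` {y \<in> D. y < x} \<inter> ?I = {}"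
    using assms by auto
  ultimately show ?thesis
    using assms by (simp add: cross_def card_Un_disjoint card_image inj_on_def)
qed

lemma cross_insert_right:
  assumes "finite P" "finite D" "x \<notin> D"
  shows "cross P (insert x D) = card {a \<in> P. a > x} + cross P D"
proof -
  let ?I = "{(a, y) \<in> P \<times> D. a > y}"
  have "{(a, y) \<in> P \<times> insert x D. a > y} = (\<lambda>a. (a, x)) ` {a \<in> P. a > x} \<union> ?I"
    by auto
  moreover have "finite ?I"
    using assms by (auto intro: finite_subset[of _ "P \<times> D"])
  moreover have "(\<lambda>a. (a, x)) ` {a \<in> P. a > x} \<inter> ?I = {}"
    using assms by auto
  ultimately show ?thesis
    using assms by (simp add: cross_def card_Un_disjoint card_image inj_on_def)
qed

lemma inv_num_append:
  assumes "distinct (p @ d)"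
  shows "inv_num (p @ d) = inv_num p + inv_num d + cross (set p) (set d)"
  using assms
proof (induction p)
  case (Cons x p)
  have "card {y \<in> set p \<union> set d. y < x} = card {y \<in> set p. y < x} + card {y \<in> set d. y < x}"
    using Cons.prems by (subst card_Un_disjoint[symmetric]) (auto intro: arg_cong[of _ _ card])
  with Cons show ?case
    by (simp add: inv_num_Cons cross_insert_left)
qed (simp add: cross_def)

lemma inv_num_increasing: "sorted_wrt (<) p \<Longrightarrow> inv_num p = 0"
proof (induction p)
  case (Cons x p)
  then have "{y \<in> set p. y < x} = {}" "distinct (x # p)"
    by (auto simp: strict_sorted_iff)
  then show ?case
    using Cons by (simp add: inv_num_Cons)
qed simp

text \<open>The summand takes both blocks as arguments, so that a new letter is simply inserted into
  one or the other.\<close>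

lemma sum_Pow_insert:
  fixes g :: "'b set \<Rightarrow> 'b set \<Rightarrow> 'a :: comm_monoid_add"
  assumes "finite L" "x \<notin> L"
  shows "(\<Sum>P\<in>Pow (insert x L). g P (insert x L - P)) =
    (\<Sum>P\<in>Pow L. g (insert x P) (L - P) + g P (insert x (L - P)))"
proof -
  have "(\<Sum>P\<in>Pow (insert x L). g P (insert x L - P)) =
      (\<Sum>P\<in>Pow L. g P (insert x L - P)) + (\<Sum>P\<in>insert x ` Pow L. g P (insert x L - P))"
    using assms by (subst Pow_insert, subst sum.union_disjoint) auto
  also have "(\<Sum>P\<in>insert x ` Pow L. g P (insert x L - P)) = (\<Sum>P\<in>Pow L. g (insert x P) (L - P))"
    using assms
    by (subst sum.reindex) (auto simp: inj_on_def intro!: sum.cong arg_cong2[of _ _ _ _ g])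
  also have "(\<Sum>P\<in>Pow L. g P (insert x L - P)) = (\<Sum>P\<in>Pow L. g P (insert x (L - P)))"
    using assms by (intro sum.cong) (auto intro!: arg_cong2[of _ _ _ _ g])
  finally show ?thesis
    by (simp add: sum.distrib add.commute)
qed

section \<open>A Pascal-type recurrence\<close>

text \<open>Total weight of the lattice paths from the origin to \<open>(s, m)\<close>, where a step
  out of \<open>(s, m)\<close> weighs \<open>a s m\<close> when it raises \<open>s\<close> and
  \<open>b s m\<close> when it raises \<open>m\<close>.\<close>

fun pascal :: "(nat \<Rightarrow> nat \<Rightarrow> 'a) \<Rightarrow> (nat \<Rightarrow> nat \<Rightarrow> 'a) \<Rightarrow> nat \<Rightarrow> nat \<Rightarrow> 'a :: comm_semiring_1" where
  "pascal a b 0 0 = 1"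
| "pascal a b (Suc s) 0 = a s 0 * pascal a b s 0"
| "pascal a b 0 (Suc m) = b 0 m * pascal a b 0 m"
| "pascal a b (Suc s) (Suc m) = a s (Suc m) * pascal a b s (Suc m) + b (Suc s) m * pascal a b (Suc s) m"

text \<open>Passes from one antidiagonal to the next by splitting paths according to their last
  step. The arbitrary \<open>f\<close> lets the inductions below absorb the weights of an inserted
  letter into a new test function.\<close>

lemma pascal_step:
  "(\<Sum>s\<le>n. pascal a b s (n - s) * (a s (n - s) * f (Suc s) (n - s) + b s (n - s) * f s (Suc (n - s)))) =
   (\<Sum>s\<le>Suc n. pascal a b s (Suc n - s) * f s (Suc n - s))"
proof -
  \<comment> \<open>Contributions of the two kinds of last step, set to 0 on the border; this merges
    the defining equations of \<open>pascal\<close> away from the origin, which is not on the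
    antidiagonal \<open>Suc n\<close>.\<close>
  define A where "A s m = (case s of 0 \<Rightarrow> 0 | Suc s \<Rightarrow> a s m * pascal a b s m)" for s m
  define C where "C s m = (case m of 0 \<Rightarrow> 0 | Suc m \<Rightarrow> b s m * pascal a b s m)" for s m
  have "pascal a b s (Suc n - s) = A s (Suc n - s) + C s (Suc n - s)" if "s \<le> Suc n" for s
    using that by (cases s; cases "Suc n - s") (auto simp: A_def C_def)
  then have "(\<Sum>s\<le>Suc n. pascal a b s (Suc n - s) * f s (Suc n - s)) =
      (\<Sum>s\<le>Suc n. A s (Suc n - s) * f s (Suc n - s)) + (\<Sum>s\<le>Suc n. C s (Suc n - s) * f s (Suc n - s))"
    by (simp add: distrib_right flip: sum.distrib del: sum.atMost_Suc)
  also have "(\<Sum>s\<le>Suc n. A s (Suc n - s) * f s (Suc n - s)) =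
      (\<Sum>s\<le>n. a s (n - s) * pascal a b s (n - s) * f (Suc s) (n - s))"
    by (subst sum.atMost_Suc_shift) (simp add: A_def)
  also have "(\<Sum>s\<le>Suc n. C s (Suc n - s) * f s (Suc n - s)) =
      (\<Sum>s\<le>n. b s (n - s) * pascal a b s (n - s) * f s (Suc (n - s)))"
    by (simp add: C_def Suc_diff_le)
  finally show ?thesis
    by (simp add: algebra_simps sum.distrib)
qed

section \<open>Finite q-shifted factorials and the closed form of the recurrence\<close>

lemma qpoch_0 [simp]: "qpoch a q 0 = 1"
  by (simp add: qpoch_def)

lemma qpoch_Suc: "qpoch a q (Suc n) = qpoch a q n * (1 - a * q ^ n)"
  by (simp add: qpoch_def)

lemma qpoch_Suc': "qpoch a q (Suc n) = (1 - a) * qpoch (a * q) q n"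
  by (simp add: qpoch_def prod.lessThan_Suc_shift ac_simps del: prod.lessThan_Suc)

lemma qpoch_add: "qpoch a q (s + m) = qpoch a q s * qpoch (a * q ^ s) q m"
  by (induction m) (simp_all add: qpoch_Suc power_add ac_simps)

text \<open>
  The entry at \<open>(s, m)\<close> collects the pairs with \<open>card P = s\<close> and \<open>card (L - P) = m\<close>; the coefficients are
  the factors contributed by a letter of absolute value \<open>s + m + 1\<close> added to \<open>P\<close> (\<open>y0\<close> or \<open>y1\<close>) or to
  \<open>L - P\<close>.  The values \<open>y0 = 1\<close>, \<open>y1 = z = 0\<close> give the \<open>q\<close>-binomial coefficients.
\<close>

definition signed_pascal :: "'a :: comm_ring_1 \<Rightarrow> 'a \<Rightarrow> 'a \<Rightarrow> 'a \<Rightarrow> nat \<Rightarrow> nat \<Rightarrow> 'a" where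
  "signed_pascal q y0 y1 z =
     pascal (\<lambda>s m. q ^ m * (y0 + q ^ Suc s * y1 * z)) (\<lambda>s m. 1 + q ^ Suc (2 * s + m) * z)"

text \<open>Denominators are cleared, so the identity makes sense in every commutative ring. With
  \<open>A = q ^ Suc s\<close> and \<open>M = q ^ Suc m\<close>, the inductive step reduces to
  \<open>M(1-A)(1+zA) + (1-M)(1+zA^2M) = (1-AM)(1+zAM)\<close>.\<close>

lemma signed_pascal_closed:
  "signed_pascal q y0 y1 z s m * (qpoch q q s * qpoch q q m) =
     qpoch q q (s + m) * qpoch (- z * q ^ Suc s) q m * (\<Prod>i<s. y0 + q ^ Suc i * y1 * z)"
proof -
  let ?a = "\<lambda>s m. q ^ m * (y0 + q ^ Suc s * y1 * z)"
  let ?b = "\<lambda>s m. 1 + q ^ Suc (2 * s + m) * z"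
  let ?Pi = "\<lambda>s. \<Prod>i<s. y0 + q ^ Suc i * y1 * z"
  have "pascal ?a ?b s m * (qpoch q q s * qpoch q q m) =
      qpoch q q (s + m) * qpoch (- z * q ^ Suc s) q m * ?Pi s"
  proof (induction ?a ?b s m rule: pascal.induct)
    case (4 s m)
    let ?R = "qpoch (- z * q ^ Suc (Suc s)) q m"
    \<comment> \<open>Peeling off the first factor exposes the product \<open>?R\<close> common to
      both induction hypotheses.\<close>
    have R: "qpoch (- (q * (z * q ^ s))) q (Suc m) = (1 + z * q ^ Suc s) * ?R"
      by (simp add: qpoch_Suc' ac_simps)
    have "pascal ?a ?b (Suc s) (Suc m) * (qpoch q q (Suc s) * qpoch q q (Suc m)) =
        ?a s (Suc m) * (1 - q ^ Suc s) * (pascal ?a ?b s (Suc m) * (qpoch q q s * qpoch q q (Suc m))) +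
        ?b (Suc s) m * (1 - q ^ Suc m) * (pascal ?a ?b (Suc s) m * (qpoch q q (Suc s) * qpoch q q m))"
      by (simp add: qpoch_Suc algebra_simps del: power_Suc) (simp add: algebra_simps)
    also have "\<dots> = ?a s (Suc m) * (1 - q ^ Suc s) *
          (qpoch q q (Suc (s + m)) * ((1 + z * q ^ Suc s) * ?R) * ?Pi s) +
        ?b (Suc s) m * (1 - q ^ Suc m) * (qpoch q q (Suc (s + m)) * ?R * (?Pi s * (y0 + q ^ Suc s * y1 * z)))"
      unfolding "4.hyps" by (simp add: R ac_simps)
    also have "\<dots> = qpoch q q (Suc (s + m)) * ?R * ?Pi s * (y0 + q ^ Suc s * y1 * z) *
        (q ^ Suc m * (1 - q ^ Suc s) * (1 + z * q ^ Suc s) +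
         (1 - q ^ Suc m) * (1 + q ^ Suc (2 * Suc s + m) * z))"
      by (simp only: algebra_simps)
    also have "q ^ Suc m * (1 - q ^ Suc s) * (1 + z * q ^ Suc s) +
         (1 - q ^ Suc m) * (1 + q ^ Suc (2 * Suc s + m) * z) =
       (1 - q ^ Suc (Suc s + m)) * (1 + z * q ^ (Suc (Suc s) + m))"
      by (simp add: algebra_simps power_add mult_2 del: power_Suc)
        (simp add: algebra_simps power_add mult_2_right)
    finally show ?case
      by (simp add: qpoch_Suc power_add algebra_simps)
  qed (simp_all add: qpoch_Suc power_add algebra_simps)
  then show ?thesis
    by (simp add: signed_pascal_def)
qed

section \<open>The desarrangement polynomials\<close>

text \<open>Letters are inserted in increasing order. The new maximum creates an inversion with
  every letter of \<open>L - P\<close> if it joins \<open>P\<close>, and none if it joins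
  \<open>L - P\<close>.\<close>

lemma sum_Pow_cross:
  fixes q :: "'a :: comm_ring_1"
  assumes "finite L"
  shows "(\<Sum>P\<in>Pow L. q ^ cross P (L - P) * f (card P) (card (L - P))) =
    (\<Sum>s\<le>card L. signed_pascal q 1 0 0 s (card L - s) * f s (card L - s))"
  using assms
proof (induction L arbitrary: f rule: finite_linorder_max_induct)
  case empty
  then show ?case by (simp add: cross_def signed_pascal_def)
next
  case (insert b L)
  define f' where "f' s m = q ^ m * f (Suc s) m + f s (Suc m)" for s m
  have b: "b \<notin> L" using insert.hyps by auto
  have "(\<Sum>P\<in>Pow (insert b L). q ^ cross P (insert b L - P) * f (card P) (card (insert b L - P))) =
      (\<Sum>P\<in>Pow L. q ^ cross (insert b P) (L - P) * f (card (insert b P)) (card (L - P)) +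
         q ^ cross P (insert b (L - P)) * f (card P) (card (insert b (L - P))))"
    using sum_Pow_insert[of L b "\<lambda>P D. q ^ cross P D * f (card P) (card D)"] insert.hyps b by simp
  also have "\<dots> = (\<Sum>P\<in>Pow L. q ^ cross P (L - P) * f' (card P) (card (L - P)))"
  proof (intro sum.cong refl)
    fix P assume "P \<in> Pow L"
    then have "finite P"
      using insert.hyps(1) by (auto intro: finite_subset)
    with \<open>P \<in> Pow L\<close> have P: "finite P" "b \<notin> P" "finite (L - P)" "b \<notin> L - P"
        "{y \<in> L - P. y < b} = L - P" "{a \<in> P. a > b} = {}"
      using insert.hyps b by (auto dest!: subsetD dest: less_asym)
    then have "cross (insert b P) (L - P) = card (L - P) + cross P (L - P)"
        "cross P (insert b (L - P)) = cross P (L - P)"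
      by (simp_all only: cross_insert_left cross_insert_right card.empty add_0 simp_thms)
    then show "q ^ cross (insert b P) (L - P) * f (card (insert b P)) (card (L - P)) +
        q ^ cross P (insert b (L - P)) * f (card P) (card (insert b (L - P))) =
        q ^ cross P (L - P) * f' (card P) (card (L - P))"
      using P by (simp add: f'_def power_add algebra_simps del: Diff_iff finite_Diff2)
  qed
  also have "\<dots> = (\<Sum>s\<le>card L. signed_pascal q 1 0 0 s (card L - s) * f' s (card L - s))"
    by (rule insert.IH)
  also have "\<dots> = (\<Sum>s\<le>Suc (card L). signed_pascal q 1 0 0 s (Suc (card L) - s) * f s (Suc (card L) - s))"
    using pascal_step[of "\<lambda>s m. q ^ m" "\<lambda>s m. 1" "card L" f]
    by (simp add: signed_pascal_def f'_def)
  finally show ?case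
    using insert.hyps b by simp
qed

section \<open>The distribution of the inversion number over all permutations\<close>

lemma sum_power_card_less:
  fixes q :: "'a :: comm_semiring_1"
  assumes "finite (L :: int set)"
  shows "(\<Sum>x\<in>L. q ^ card {y \<in> L. y < x}) = (\<Sum>j<card L. q ^ j)"
  using assms
proof (induction L rule: finite_linorder_max_induct)
  case (insert b L)
  have b: "b \<notin> L" and "{y \<in> insert b L. y < b} = L"
    using insert.hyps by auto
  moreover have "{y \<in> insert b L. y < x} = {y \<in> L. y < x}" if "x \<in> L" for x
    using insert.hyps that by auto
  ultimately show ?case
    using insert by (simp add: add.commute)
qed simp

text \<open>The classical q-factorial formula: the first letter contributes its rank in
  \<open>L\<close>, which ranges over \<open>0, ..., card L - 1\<close>.\<close>

lemma sum_inv_num: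
  fixes q :: "'a :: comm_semiring_1"
  assumes "finite L"
  shows "(\<Sum>w\<in>permutations_of_set L. q ^ inv_num w) = (\<Prod>i<card L. \<Sum>j<Suc i. q ^ j)"
  using assms
proof (induction "card L" arbitrary: L)
  case (Suc n)
  then have "L \<noteq> {}" by auto
  then have "(\<Sum>w\<in>permutations_of_set L. q ^ inv_num w) =
      (\<Sum>x\<in>L. \<Sum>w\<in>(#) x ` permutations_of_set (L - {x}). q ^ inv_num w)"
    using Suc.prems by (subst permutations_of_set_nonempty, simp, subst sum.UNION_disjoint) auto
  also have "\<dots> = (\<Sum>x\<in>L. \<Sum>w\<in>permutations_of_set (L - {x}). q ^ card {y \<in> L. y < x} * q ^ inv_num w)"
  proof (rule sum.cong[OF refl])
    fix x assume "x \<in> L"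
    have "{y \<in> L - {x}. y < x} = {y \<in> L. y < x}" by auto
    then show "(\<Sum>w\<in>(#) x ` permutations_of_set (L - {x}). q ^ inv_num w) =
        (\<Sum>w\<in>permutations_of_set (L - {x}). q ^ card {y \<in> L. y < x} * q ^ inv_num w)"
      by (subst sum.reindex)
        (auto simp: inv_num_Cons permutations_of_set_def power_add intro!: sum.cong)
  qed
  also have "\<dots> = (\<Sum>x\<in>L. q ^ card {y \<in> L. y < x} * (\<Prod>i<n. \<Sum>j<Suc i. q ^ j))"
    using Suc.hyps(1)[of "L - {_}"] Suc.hyps(2)[symmetric] Suc.prems
    by (intro sum.cong) (auto simp flip: sum_distrib_left)
  also have "\<dots> = (\<Prod>i<Suc n. \<Sum>j<Suc i. q ^ j)"
    using Suc.hyps(2)[symmetric] sum_power_card_less[OF Suc.prems, of q]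
    by (simp add: mult.commute flip: sum_distrib_right)
  finally show ?case
    using Suc.hyps(2) by simp
qed simp

lemma qpoch_eq_prod_sum:
  "qpoch q q n = (1 - q) ^ n * (\<Prod>i<n. \<Sum>j<Suc i. q ^ j)"
proof -
  have "qpoch q q n = (\<Prod>i<n. 1 - q ^ Suc i)"
    by (simp add: qpoch_def)
  also have "\<dots> = (\<Prod>i<n. (1 - q) * (\<Sum>j<Suc i. q ^ j))"
    by (simp only: one_diff_power_eq)
  finally show ?thesis
    by (simp add: prod.distrib)
qed

section \<open>Inversion sums over desarrangements\<close>

definition desarr_sum :: "'a :: comm_ring_1 \<Rightarrow> int set \<Rightarrow> 'a" where
  "desarr_sum q L = (\<Sum>d | d \<in> permutations_of_set L \<and> desarrangement d. q ^ inv_num d)"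

abbreviation desarr_poly :: "'a :: comm_ring_1 \<Rightarrow> nat \<Rightarrow> 'a" where
  "desarr_poly q n \<equiv> desarr_sum q {1..int n}"

text \<open>The increasing factor has no inversions of its own, so those of a word come from
  \<open>d\<close> and from across the cut.\<close>

lemma sum_inv_num_desarr_sum:
  assumes "finite L"
  shows "(\<Prod>i<card L. \<Sum>j<Suc i. q ^ j) = (\<Sum>P\<in>Pow L. q ^ cross P (L - P) * desarr_sum q (L - P))"
proof -
  have "inv_num (sorted_list_of_set P @ d) = cross P (L - P) + inv_num d"
    if "P \<subseteq> L" "d \<in> permutations_of_set (L - P)" for P d
  proof -
    have "finite P" "set d = L - P" "distinct d"
      using that assms by (auto intro: finite_subset simp: permutations_of_set_def)
    then show ?thesis
      by (subst inv_num_append) (auto simp: inv_num_increasing)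
  qed
  then have "(\<Sum>P\<in>Pow L. \<Sum>d | d \<in> permutations_of_set (L - P) \<and> desarrangement d.
        q ^ inv_num (sorted_list_of_set P @ d)) =
      (\<Sum>P\<in>Pow L. q ^ cross P (L - P) * desarr_sum q (L - P))"
    by (auto simp: desarr_sum_def sum_distrib_left power_add intro!: sum.cong)
  then show ?thesis
    using assms
    by (simp add: sum_permutations_of_set_desarrangement flip: sum_inv_num del: sum.lessThan_Suc)
qed

text \<open>
  By induction on \<open>card L\<close>: in the preceding identity only the term \<open>P = {}\<close> involves all of \<open>L\<close>.
\<close>

lemma desarr_sum_card:
  assumes "finite L"
  shows "desarr_sum q L = desarr_poly q (card L)"
  using assms
proof (induction "card L" arbitrary: L rule: less_induct)
  case less
  \<comment> \<open>The value 0 at \<open>s = 0\<close> drops the term \<open>P = {}\<close>, so the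
    remaining sum can still be taken over the whole power set and evaluated by
    \<open>sum_Pow_cross\<close>.\<close>
  define f where "f s m = (if s = 0 then 0 else desarr_poly q m)" for s m :: nat
  have eq: "desarr_sum q M = (\<Prod>i<card L. \<Sum>j<Suc i. q ^ j) -
      (\<Sum>s\<le>card L. signed_pascal q 1 0 0 s (card L - s) * f s (card L - s))"
    if "finite M" "card M = card L" for M
  proof -
    have "cross {} M = 0" by (simp add: cross_def)
    then have "(\<Prod>i<card M. \<Sum>j<Suc i. q ^ j) = desarr_sum q M +
        (\<Sum>P\<in>Pow M - {{}}. q ^ cross P (M - P) * desarr_sum q (M - P))"
      using that sum_inv_num_desarr_sum[OF that(1), of q]
      by (simp add: sum.remove[of "Pow M" "{}"] del: sum.lessThan_Suc)
    also have "(\<Sum>P\<in>Pow M - {{}}. q ^ cross P (M - P) * desarr_sum q (M - P)) =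
        (\<Sum>P\<in>Pow M - {{}}. q ^ cross P (M - P) * f (card P) (card (M - P)))"
    proof (intro sum.cong refl)
      fix P assume P: "P \<in> Pow M - {{}}"
      then have fin: "finite P" using that finite_subset by blast
      with P have "card P > 0" by (simp add: card_gt_0_iff)
      moreover have "card (M - P) < card L"
        using P fin that \<open>card P > 0\<close> card_mono[of M P] by (simp add: card_Diff_subset)
      ultimately show "q ^ cross P (M - P) * desarr_sum q (M - P) =
          q ^ cross P (M - P) * f (card P) (card (M - P))"
        using less.hyps[of "M - P"] that by (simp add: f_def)
    qed
    also have "\<dots> = (\<Sum>P\<in>Pow M. q ^ cross P (M - P) * f (card P) (card (M - P)))"
      using that by (simp add: f_def sum.remove[of "Pow M" "{}"])
    also have "\<dots> = (\<Sum>s\<le>card L. signed_pascal q 1 0 0 s (card L - s) * f s (card L - s))"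
      using sum_Pow_cross[OF that(1), of q f] that(2) by simp
    finally show ?thesis
      using that by simp
  qed
  show ?case
    \<comment> \<open>\<open>eq\<close> has the same right-hand side for every set of size
      \<open>card L\<close>, in particular for the reference interval.\<close>
    using eq[of L] eq[of "{1..int (card L)}"] less.prems by simp
qed

lemma desarr_poly_recurrence:
  "(\<Sum>s\<le>n. signed_pascal q 1 0 0 s (n - s) * desarr_poly q (n - s)) = (\<Prod>i<n. \<Sum>j<Suc i. q ^ j)"
  using sum_Pow_cross[of "{1..int n}" q "\<lambda>s m. desarr_poly q m"]
    sum_inv_num_desarr_sum[of "{1..int n}" q]
  by (simp add: desarr_sum_card[of "{1..int n} - _"])

section \<open>Summation over signed permutations\<close>

text \<open>The possible letter sets of signed permutations: one sign chosen for each absolute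
  value.\<close>

definition signed_sets :: "nat \<Rightarrow> int set set" where
  "signed_sets n = {L. inj_on abs L \<and> abs ` L = {1..int n}}"

lemma signed_setsD:
  assumes "L \<in> signed_sets n"
  shows "finite L" "card L = n" "L \<subseteq> {- int n..int n}" "0 \<notin> L"
proof -
  have L: "inj_on abs L" "abs ` L = {1..int n}"
    using assms by (auto simp: signed_sets_def)
  then show "finite L" "card L = n"
    using finite_imageD[of abs L] card_image[of abs L] by auto
  have "\<bar>x\<bar> \<in> {1..int n}" if "x \<in> L" for x
    using L(2) that by blast
  then show "L \<subseteq> {- int n..int n}" "0 \<notin> L"
    by (force simp: abs_le_iff)+
qed

lemma finite_signed_sets: "finite (signed_sets n)"
  by (rule finite_subset[of _ "Pow {- int n..int n}"]) (auto dest: signed_setsD(3))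

lemma signed_sets_0: "signed_sets 0 = {{}}"
  by (auto simp: signed_sets_def)

lemma signed_sets_Suc:
  "signed_sets (Suc n) =
     insert (int (Suc n)) ` signed_sets n \<union> insert (- int (Suc n)) ` signed_sets n"
proof (intro equalityI subsetI)
  fix L assume "L \<in> signed_sets (Suc n)"
  then have L: "inj_on abs L" "abs ` L = {1..int (Suc n)}"
    by (auto simp: signed_sets_def)
  then have "int (Suc n) \<in> abs ` L" by simp
  then obtain x where x: "x \<in> L" "\<bar>x\<bar> = int (Suc n)" by auto
  have "abs ` (L - {x}) = {1..int (Suc n)} - {int (Suc n)}"
    using L x inj_on_image_set_diff[of abs L L "{x}"] by simp
  also have "\<dots> = {1..int n}" by auto
  finally have "L - {x} \<in> signed_sets n"
    using L(1) by (auto simp: signed_sets_def intro: inj_on_subset)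
  moreover have "L = insert x (L - {x})" "x = int (Suc n) \<or> x = - int (Suc n)"
    using x by auto
  ultimately show "L \<in> insert (int (Suc n)) ` signed_sets n \<union> insert (- int (Suc n)) ` signed_sets n"
    by (metis UnI1 UnI2 imageI)
next
  fix L assume "L \<in> insert (int (Suc n)) ` signed_sets n \<union> insert (- int (Suc n)) ` signed_sets n"
  then obtain x M where x: "L = insert x M" "\<bar>x\<bar> = int (Suc n)" "M \<in> signed_sets n" by auto
  then have "x \<notin> M" using signed_setsD(3)[of M n] by (auto dest!: subsetD)
  moreover have "{1..int (Suc n)} = insert (int (Suc n)) {1..int n}" by auto
  ultimately show "L \<in> signed_sets (Suc n)"
    using x by (auto simp: signed_sets_def)
qed

lemma signed_perms_eq: "signed_perms n = (\<Union>L\<in>signed_sets n. permutations_of_set L)"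
proof (intro equalityI subsetI)
  fix w assume "w \<in> signed_perms n"
  then have "set w \<in> signed_sets n" "w \<in> permutations_of_set (set w)"
    by (auto simp: signed_perms_def signed_sets_def permutations_of_set_def distinct_map)
  then show "w \<in> (\<Union>L\<in>signed_sets n. permutations_of_set L)" by blast
next
  fix w assume "w \<in> (\<Union>L\<in>signed_sets n. permutations_of_set L)"
  then obtain L where L: "L \<in> signed_sets n" "set w = L" "distinct w"
    by (auto simp: permutations_of_set_def)
  then show "w \<in> signed_perms n"
    using signed_setsD(3,4)[OF L(1)]
    by (auto simp: signed_perms_def signed_sets_def permutations_of_set_def distinct_map)
qed

section \<open>Weights of pairs of letter sets\<close>

definition neg_sum :: "int set \<Rightarrow> nat" where
  "neg_sum A = (\<Sum>x | x \<in> A \<and> x < 0. nat \<bar>x\<bar>)"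

text \<open>The whole weight of a signed permutation with increasing part on \<open>P\<close> and
  desarrangement \<open>d\<close> on \<open>D\<close>, except for the factor
  \<open>q ^ inv_num d\<close>.\<close>

definition weight :: "'a :: comm_ring_1 \<Rightarrow> 'a \<Rightarrow> 'a \<Rightarrow> 'a \<Rightarrow> int set \<Rightarrow> int set \<Rightarrow> 'a" where
  "weight q y0 y1 z P D = q ^ (cross P D + neg_sum P + neg_sum D) *
     y0 ^ card {x \<in> P. x > 0} * y1 ^ card {x \<in> P. x < 0} *
     z ^ (card {x \<in> P. x < 0} + card {x \<in> D. x < 0})"

text \<open>\<open>N\<close> exceeds every letter present and \<open>- N\<close> lies below all of
  them. New inversions across the cut therefore arise only for \<open>N\<close> in \<open>P\<close>
  (\<open>card D\<close> of them) and \<open>- N\<close> in \<open>D\<close>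
  (\<open>card P\<close>); a negative letter adds \<open>Suc n\<close> more to the length.\<close>

lemma weight_insert:
  fixes P D :: "int set" and k :: nat
  assumes "P \<subseteq> {- int n..int n}" "D \<subseteq> {- int n..int n}"
  defines "N \<equiv> int (Suc n)"
  shows "weight q y0 y1 z (insert N P) D = q ^ card D * y0 * weight q y0 y1 z P D"
    and "weight q y0 y1 z (insert (- N) P) D = q ^ Suc n * y1 * z * weight q y0 y1 z P D"
    and "weight q y0 y1 z P (insert N D) = weight q y0 y1 z P D"
    and "weight q y0 y1 z P (insert (- N) D) = q ^ (card P + Suc n) * z * weight q y0 y1 z P D"
proof -
  have fin: "finite P" "finite D"
    using assms finite_subset by blast+
  have N: "N > 0" "nat N = Suc n" by (auto simp: N_def)
  have out: "N \<notin> P" "N \<notin> D" "- N \<notin> P" "- N \<notin> D"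
    using assms by (auto simp: N_def)
  have cross: "cross (insert N P) D = card D + cross P D" "cross (insert (- N) P) D = cross P D"
      "cross P (insert N D) = cross P D" "cross P (insert (- N) D) = card P + cross P D"
  proof -
    have "{y \<in> D. y < N} = D" "{y \<in> D. y < - N} = {}" "{a \<in> P. a > N} = {}" "{a \<in> P. a > - N} = P"
      using assms(1,2) by (auto simp: N_def)
    then show "cross (insert N P) D = card D + cross P D" "cross (insert (- N) P) D = cross P D"
      "cross P (insert N D) = cross P D" "cross P (insert (- N) D) = card P + cross P D"
      using fin out by (simp_all add: cross_insert_left cross_insert_right)
  qed
  have sign: "{x \<in> insert N A. x > 0} = insert N {x \<in> A. x > 0}"
      "{x \<in> insert N A. x < 0} = {x \<in> A. x < 0}"
      "{x \<in> insert (- N) A. x > 0} = {x \<in> A. x > 0}"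
      "{x \<in> insert (- N) A. x < 0} = insert (- N) {x \<in> A. x < 0}" for A
    using N by auto
  have ns: "neg_sum (insert N A) = neg_sum A"
      "finite A \<Longrightarrow> - N \<notin> A \<Longrightarrow> neg_sum (insert (- N) A) = Suc n + neg_sum A" for A
    using sign[of A] N by (simp_all add: neg_sum_def)
  show "weight q y0 y1 z (insert N P) D = q ^ card D * y0 * weight q y0 y1 z P D"
      "weight q y0 y1 z (insert (- N) P) D = q ^ Suc n * y1 * z * weight q y0 y1 z P D"
      "weight q y0 y1 z P (insert N D) = weight q y0 y1 z P D"
      "weight q y0 y1 z P (insert (- N) D) = q ^ (card P + Suc n) * z * weight q y0 y1 z P D"
    using fin out unfolding weight_def cross sign by (simp_all add: ns power_add mult_ac)
qed

lemma sum_signed_sets_Suc: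
  fixes h :: "int set \<Rightarrow> 'a :: comm_monoid_add"
  shows "(\<Sum>L\<in>signed_sets (Suc n). h L) =
    (\<Sum>L\<in>signed_sets n. h (insert (int (Suc n)) L) + h (insert (- int (Suc n)) L))"
proof -
  note fin = finite_signed_sets[of n]
  have out: "int (Suc n) \<notin> L" "- int (Suc n) \<notin> L" if "L \<in> signed_sets n" for L
    using signed_setsD(3)[OF that] by auto
  have "insert x L = insert x M \<longleftrightarrow> L = M" if "x \<notin> L" "x \<notin> M" for x :: int and L M
    using that by (metis insert_ident)
  then have "inj_on (insert (int (Suc n))) (signed_sets n)" "inj_on (insert (- int (Suc n))) (signed_sets n)"
    using out by (auto intro!: inj_onI simp del: of_nat_Suc)
  moreover have "insert (int (Suc n)) ` signed_sets n \<inter> insert (- int (Suc n)) ` signed_sets n = {}"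
    using out by (fastforce simp del: of_nat_Suc)
  ultimately show ?thesis
    using fin by (simp add: signed_sets_Suc sum.union_disjoint sum.reindex sum.distrib del: of_nat_Suc)
qed

lemma sum_signed_sets_weight:
  "(\<Sum>L\<in>signed_sets n. \<Sum>P\<in>Pow L. weight q y0 y1 z P (L - P) * f (card P) (card (L - P))) =
   (\<Sum>s\<le>n. signed_pascal q y0 y1 z s (n - s) * f s (n - s))"
proof (induction n arbitrary: f)
  case 0
  then show ?case by (simp add: signed_sets_0 weight_def cross_def neg_sum_def signed_pascal_def)
next
  case (Suc n)
  let ?N = "int (Suc n)"
  let ?a = "\<lambda>s m. q ^ m * (y0 + q ^ Suc s * y1 * z)"
  let ?b = "\<lambda>s m. 1 + q ^ Suc (2 * s + m) * z"
  define g where "g P D = weight q y0 y1 z P D * f (card P) (card D)" for P D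
  define f' where "f' s m = ?a s m * f (Suc s) m + ?b s m * f s (Suc m)" for s m
  have "(\<Sum>L\<in>signed_sets (Suc n). \<Sum>P\<in>Pow L. g P (L - P)) =
      (\<Sum>L\<in>signed_sets n. \<Sum>P\<in>Pow L. weight q y0 y1 z P (L - P) * f' (card P) (card (L - P)))"
    unfolding sum_signed_sets_Suc
  proof (intro sum.cong refl)
    fix L assume L: "L \<in> signed_sets n"
    have out: "?N \<notin> L" "- ?N \<notin> L" and "finite L"
      using signed_setsD(1,3)[OF L] by auto
    then have "(\<Sum>P\<in>Pow (insert ?N L). g P (insert ?N L - P)) +
          (\<Sum>P\<in>Pow (insert (- ?N) L). g P (insert (- ?N) L - P)) =
        (\<Sum>P\<in>Pow L. (g (insert ?N P) (L - P) + g P (insert ?N (L - P))) +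
           (g (insert (- ?N) P) (L - P) + g P (insert (- ?N) (L - P))))"
      using sum_Pow_insert[of L ?N g] sum_Pow_insert[of L "- ?N" g] by (simp only: sum.distrib simp_thms)
    also have "\<dots> = (\<Sum>P\<in>Pow L. weight q y0 y1 z P (L - P) * f' (card P) (card (L - P)))"
    proof (intro sum.cong refl)
      fix P assume "P \<in> Pow L"
      define D where "D = L - P"
      have PD: "P \<subseteq> {- int n..int n}" "D \<subseteq> {- int n..int n}" "finite P" "finite D"
          "?N \<notin> P" "- ?N \<notin> P" "?N \<notin> D" "- ?N \<notin> D"
        using \<open>P \<in> Pow L\<close> signed_setsD(1,3)[OF L] out by (auto simp: D_def intro: finite_subset)
      have "card P + card D = n"
        using \<open>P \<in> Pow L\<close> \<open>finite L\<close> PD(3) signed_setsD(2)[OF L] card_mono[of L P]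
        by (simp add: D_def card_Diff_subset)
      then have n: "n = card P + card D" ..
      have "g (insert ?N P) D = q ^ card D * y0 * weight q y0 y1 z P D * f (Suc (card P)) (card D)"
        "g (insert (- ?N) P) D = q ^ Suc n * y1 * z * weight q y0 y1 z P D * f (Suc (card P)) (card D)"
        "g P (insert ?N D) = weight q y0 y1 z P D * f (card P) (Suc (card D))"
        "g P (insert (- ?N) D) = q ^ (card P + Suc n) * z * weight q y0 y1 z P D * f (card P) (Suc (card D))"
        unfolding g_def using PD by (simp_all only: weight_insert card_insert_disjoint simp_thms)
      \<comment> \<open>Since \<open>n = card P + card D\<close>, the exponents depend only on the
        block sizes, and the four insertions add up to the coefficients \<open>?a\<close> and
        \<open>?b\<close>.\<close>
      moreover have "q ^ Suc n = q ^ card D * q ^ Suc (card P)"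
          "q ^ (card P + Suc n) = q ^ Suc (2 * card P + card D)"
        by (simp_all add: n power_add mult_2)
      ultimately show "(g (insert ?N P) (L - P) + g P (insert ?N (L - P))) +
          (g (insert (- ?N) P) (L - P) + g P (insert (- ?N) (L - P))) =
          weight q y0 y1 z P (L - P) * f' (card P) (card (L - P))"
        unfolding D_def[symmetric] f'_def by (simp only:)
          (simp only: algebra_simps mult_1_left mult_1_right)
    qed
    finally show "(\<Sum>P\<in>Pow (insert ?N L). g P (insert ?N L - P)) +
          (\<Sum>P\<in>Pow (insert (- ?N) L). g P (insert (- ?N) L - P)) =
        (\<Sum>P\<in>Pow L. weight q y0 y1 z P (L - P) * f' (card P) (card (L - P)))" .
  qed
  also have "\<dots> = (\<Sum>s\<le>n. signed_pascal q y0 y1 z s (n - s) * f' s (n - s))"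
    by (rule Suc.IH)
  also have "\<dots> = (\<Sum>s\<le>Suc n. signed_pascal q y0 y1 z s (Suc n - s) * f s (Suc n - s))"
    unfolding signed_pascal_def f'_def by (rule pascal_step)
  finally show ?case
    by (simp only: g_def)
qed

lemma neg_eq_card: "distinct w \<Longrightarrow> neg w = card {x \<in> set w. x < 0}"
  by (simp add: neg_def flip: distinct_card)

lemma coxeter_length_distinct:
  assumes "distinct w"
  shows "coxeter_length w = inv_num w + neg_sum (set w)"
proof -
  have "bij_betw ((!) w) {i. i < length w \<and> w ! i < 0} {x. x \<in> set w \<and> x < 0}"
    using assms by (auto simp: bij_betw_def inj_on_def nth_eq_iff_index_eq in_set_conv_nth)
  from sum.reindex_bij_betw[OF this, of "\<lambda>x. nat \<bar>x\<bar>"] show ?thesis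
    by (simp add: coxeter_length_def neg_sum_def)
qed

text \<open>Letter set, increasing block and desarrangement are chosen in turn. For a fixed block
  the weight factors out, and the sum over \<open>d\<close> depends only on the size of
  \<open>L - P\<close>.\<close>

lemma sum_signed_perms:
  fixes q :: "'a :: comm_ring_1"
  shows "(\<Sum>w\<in>signed_perms n. q ^ coxeter_length w * y0 ^ pix_plus w * y1 ^ pix_minus w * z ^ neg w) =
    (\<Sum>s\<le>n. signed_pascal q y0 y1 z s (n - s) * desarr_poly q (n - s))"
proof -
  let ?g = "\<lambda>w. q ^ coxeter_length w * y0 ^ pix_plus w * y1 ^ pix_minus w * z ^ neg w"
  note fin = finite_signed_sets[of n]
  have "(\<Sum>w\<in>signed_perms n. ?g w) = (\<Sum>L\<in>signed_sets n. \<Sum>w\<in>permutations_of_set L. ?g w)"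
    unfolding signed_perms_eq
    by (rule sum.UNION_disjoint) (use fin in \<open>auto dest: permutations_of_setD\<close>)
  also have "\<dots> = (\<Sum>L\<in>signed_sets n. \<Sum>P\<in>Pow L.
      weight q y0 y1 z P (L - P) * desarr_poly q (card (L - P)))"
  proof (rule sum.cong[OF refl])
    fix L assume L: "L \<in> signed_sets n"
    note finL = signed_setsD(1)[OF L]
    have "(\<Sum>w\<in>permutations_of_set L. ?g w) = (\<Sum>P\<in>Pow L.
        \<Sum>d | d \<in> permutations_of_set (L - P) \<and> desarrangement d. ?g (sorted_list_of_set P @ d))"
      using finL by (rule sum_permutations_of_set_desarrangement)
    also have "\<dots> = (\<Sum>P\<in>Pow L. \<Sum>d | d \<in> permutations_of_set (L - P) \<and> desarrangement d.
        weight q y0 y1 z P (L - P) * q ^ inv_num d)"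
    proof (intro sum.cong refl)
      fix P d assume P: "P \<in> Pow L" and "d \<in> {d. d \<in> permutations_of_set (L - P) \<and> desarrangement d}"
      then have d: "set d = L - P" "distinct d" "desarrangement d"
        by (auto simp: permutations_of_set_def)
      have finP: "finite P" using P finL finite_subset by blast
      let ?p = "sorted_list_of_set P"
      have p: "set ?p = P" "sorted_wrt (<) ?p" "distinct (?p @ d)"
        using finP d by auto
      have "?p @ d \<in> permutations_of_set L"
        using P d p by (auto simp: permutations_of_set_def)
      then have "?p @ d \<in> signed_perms n"
        using L by (auto simp: signed_perms_eq)
      note pix = pix_append[OF this p(2) d(3)]
      have ns: "neg_sum (P \<union> (L - P)) = neg_sum P + neg_sum (L - P)"
      proof -
        have "{x. x \<in> P \<union> (L - P) \<and> x < 0} = {x. x \<in> P \<and> x < 0} \<union> {x. x \<in> L - P \<and> x < 0}" by auto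
        then show ?thesis
          using finP finL unfolding neg_sum_def
          by (simp only:) (subst sum.union_disjoint; auto)
      qed
      have ng: "card {x \<in> P \<union> (L - P). x < 0} = card {x \<in> P. x < 0} + card {x \<in> L - P. x < 0}"
        using finP finL by (subst card_Un_disjoint[symmetric]) (auto intro: arg_cong[of _ _ card])
      have "coxeter_length (?p @ d) = cross P (L - P) + inv_num d + (neg_sum P + neg_sum (L - P))"
        unfolding coxeter_length_distinct[OF p(3)] inv_num_append[OF p(3)] set_append p(1) d(1) ns
        by (simp add: inv_num_increasing)
      moreover have "neg (?p @ d) = card {x \<in> P. x < 0} + card {x \<in> L - P. x < 0}"
        unfolding neg_eq_card[OF p(3)] set_append p(1) d(1) ng ..
      ultimately show "?g (?p @ d) = weight q y0 y1 z P (L - P) * q ^ inv_num d"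
        by (simp only: pix p(1) weight_def power_add ac_simps)
    qed
    also have "\<dots> = (\<Sum>P\<in>Pow L. weight q y0 y1 z P (L - P) * desarr_poly q (card (L - P)))"
      using finL desarr_sum_card[of "L - _" q] by (simp add: desarr_sum_def flip: sum_distrib_left)
    finally show "(\<Sum>w\<in>permutations_of_set L. ?g w) =
        (\<Sum>P\<in>Pow L. weight q y0 y1 z P (L - P) * desarr_poly q (card (L - P)))" .
  qed
  also have "\<dots> = (\<Sum>s\<le>n. signed_pascal q y0 y1 z s (n - s) * desarr_poly q (n - s))"
    by (rule sum_signed_sets_weight)
  finally show ?thesis .
qed

section \<open>Generating functions\<close>

lemma qpoch_inverse:
  "qpoch (b * var_q) var_q n * inverse (qpoch (b * var_q) var_q n) = 1"
  by (rule inverse_mult_eq_1') (simp add: qpoch_constant_term)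

lemma qpoch_var_q_inverse: "qpoch var_q var_q n * inverse (qpoch var_q var_q n) = 1"
  using qpoch_inverse[of 1] by simp

section \<open>Euler's expansion of the reciprocal of the infinite product\<close>

definition euler_series :: "qseries fps" where
  "euler_series = Abs_fps (\<lambda>n. inverse (qpoch var_q var_q n))"

text \<open>If \<open>e(u)\<close> is Euler's series, then \<open>(1 - u) e(u) = e(q u)\<close>;
  hence the first \<open>N\<close> factors turn \<open>e(u)\<close> into
  \<open>e(q^N u)\<close>.\<close>

lemma qpoch_mult_euler_series_nth:
  "fps_nth (qpoch fps_X (fps_const var_q) N * euler_series) m =
     var_q ^ (N * m) * inverse (qpoch var_q var_q m)"
proof (induction N arbitrary: m)
  case 0
  then show ?case by (simp add: euler_series_def)
next
  case (Suc N)
  let ?F = "qpoch fps_X (fps_const var_q) N * euler_series"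
  have "qpoch fps_X (fps_const var_q) (Suc N) * euler_series = ?F - fps_const (var_q ^ N) * (fps_X * ?F)"
    by (simp add: qpoch_Suc algebra_simps flip: fps_const_power)
  then have *: "fps_nth (qpoch fps_X (fps_const var_q) (Suc N) * euler_series) m =
      fps_nth ?F m - var_q ^ N * fps_nth (fps_X * ?F) m"
    by (simp only: fps_sub_nth fps_mult_left_const_nth)
  show ?case
  proof (cases m)
    case 0
    then show ?thesis using * Suc.IH[of 0] by (simp del: fps_mult_nth_0)
  next
    case (Suc k)
    let ?i = "\<lambda>k. inverse (qpoch var_q var_q k)"
    have "?i k = (qpoch var_q var_q (Suc k) * ?i (Suc k)) * ?i k"
      by (simp only: qpoch_var_q_inverse mult_1_left)
    also have "\<dots> = (qpoch var_q var_q k * ?i k) * ((1 - var_q ^ Suc k) * ?i (Suc k))"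
      by (simp only: qpoch_Suc power_Suc mult_ac)
    also have "\<dots> = (1 - var_q ^ Suc k) * ?i (Suc k)"
      by (simp only: qpoch_var_q_inverse mult_1_left)
    finally have "fps_nth ?F m - var_q ^ N * fps_nth (fps_X * ?F) m =
        var_q ^ (N * m) * ?i m - var_q ^ N * (var_q ^ (N * k) * ((1 - var_q ^ Suc k) * ?i (Suc k)))"
      using Suc.IH by (simp add: \<open>m = Suc k\<close> del: power_Suc)
    also have "\<dots> = var_q ^ (Suc N * m) * ?i m"
      by (simp add: \<open>m = Suc k\<close> power_add algebra_simps)
    finally show ?thesis using * by simp
  qed
qed

lemma qpoch_inf_mult_euler_series: "qpoch_inf fps_X (fps_const var_q) * euler_series = 1"
proof (rule fps_ext, rule fps_ext)
  fix m k
  let ?P = "\<lambda>N. qpoch fps_X (fps_const var_q) N"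
  let ?I = "qpoch_inf fps_X (fps_const var_q)"
  have "(\<lambda>N. fps_nth (?P N) i) \<longlonglongrightarrow> fps_nth ?I i" for i
    using qpoch_inf_convergent[of fps_X i] by (simp add: qpoch_inf_def convergent_LIMSEQ_iff)
  then have "\<forall>\<^sub>F N in sequentially. fps_nth (fps_nth (?P N) i) j = fps_nth (fps_nth ?I i) j" for i j
    unfolding tendsto_fps_iff by blast
  then have "\<forall>\<^sub>F N in sequentially. \<forall>i\<in>{..m}. \<forall>j\<in>{..k}.
      fps_nth (fps_nth (?P N) i) j = fps_nth (fps_nth ?I i) j"
    by (intro eventually_ball_finite ballI) auto
  then have "\<forall>\<^sub>F N in sequentially. N > k \<and> (\<forall>i\<in>{..m}. \<forall>j\<in>{..k}.
      fps_nth (fps_nth (?P N) i) j = fps_nth (fps_nth ?I i) j)"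
    using eventually_gt_at_top[of k] by eventually_elim blast
  \<comment> \<open>A coefficient of the product involves finitely many coefficients of the infinite
    product, so one \<open>N\<close> serves them all.\<close>
  then obtain N where N: "N > k" "\<And>i j. i \<le> m \<Longrightarrow> j \<le> k \<Longrightarrow>
      fps_nth (fps_nth (?P N) i) j = fps_nth (fps_nth ?I i) j"
    unfolding eventually_sequentially by blast
  have "fps_nth (fps_nth (?I * euler_series) m) k = fps_nth (fps_nth (?P N * euler_series) m) k"
    using N(2) by (simp add: fps_mult_nth fps_sum_nth)
  also have "\<dots> = fps_nth (var_q ^ (N * m) * inverse (qpoch var_q var_q m)) k"
    by (simp only: qpoch_mult_euler_series_nth)
  also have "\<dots> = fps_nth (fps_nth 1 m) k"
  \<comment> \<open>For \<open>m > 0\<close> the factor \<open>var_q ^ (N * m)\<close> has order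
    above \<open>k\<close>, so the coefficient vanishes; for \<open>m = 0\<close> the entry is
    1.\<close>
  proof (cases m)
    case (Suc m')
    then show ?thesis
      using N(1) by (simp add: var_q_def fps_X_power_mult_nth)
  qed simp
  finally show "fps_nth (fps_nth (?I * euler_series) m) k = fps_nth (fps_nth 1 m) k" .
qed

lemma signed_pascal_var_q:
  "signed_pascal var_q y0 y1 z s m =
     qpoch var_q var_q (s + m) * qpoch (- z * var_q ^ Suc s) var_q m * (\<Prod>i<s. y0 + var_q ^ Suc i * y1 * z) *
       (inverse (qpoch var_q var_q s) * inverse (qpoch var_q var_q m))"
proof -
  let ?T = "signed_pascal var_q y0 y1 z s m"
  have "?T = ?T * (qpoch var_q var_q s * inverse (qpoch var_q var_q s)) *
      (qpoch var_q var_q m * inverse (qpoch var_q var_q m))"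
    by (simp only: qpoch_var_q_inverse mult_1_right)
  also have "\<dots> = ?T * (qpoch var_q var_q s * qpoch var_q var_q m) *
      (inverse (qpoch var_q var_q s) * inverse (qpoch var_q var_q m))"
    by (simp only: mult_ac)
  finally show ?thesis
    by (simp only: signed_pascal_closed)
qed

text \<open>Since \<open>(q;q)_n\<close> is \<open>(1 - q)^n\<close> times the q-factorial, dividing
  \<open>desarr_poly_recurrence\<close> by \<open>(q;q)_n\<close> gives a convolution with value
  \<open>1/(1 - q)^n\<close>, the coefficient of a geometric series.\<close>

lemma desarr_series_mult_euler_series:
  "Abs_fps (\<lambda>m. desarr_poly var_q m * inverse (qpoch var_q var_q m)) * euler_series =
     inverse (1 - fps_const (1 / (1 - var_q)) * fps_X)"
proof -
  define c where "c = inverse (1 - var_q)"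
  have c: "c * (1 - var_q) = 1" "1 / (1 - var_q) = c"
    by (auto simp: c_def var_q_def fps_divide_unit intro: inverse_mult_eq_1)
  define E where "E = Abs_fps (\<lambda>m. desarr_poly var_q m * inverse (qpoch var_q var_q m))"
  define F where "F = 1 - fps_const c * fps_X"
  have nth: "fps_nth (E * euler_series) n = c ^ n" for n
  proof -
    let ?Q = "\<lambda>n. qpoch var_q var_q n" and ?W = "\<Prod>i<n. \<Sum>j<Suc i. var_q ^ j :: qseries"
    have "signed_pascal var_q 1 0 0 s (n - s) = ?Q n * (inverse (?Q s) * inverse (?Q (n - s)))"
      if "s \<le> n" for s
      using that by (simp add: signed_pascal_var_q) (simp add: qpoch_def)
    then have "?W = (\<Sum>s\<le>n. ?Q n * (inverse (?Q s) * inverse (?Q (n - s))) * desarr_poly var_q (n - s))"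
      using desarr_poly_recurrence[of var_q n] by simp
    also have "\<dots> = ?Q n * fps_nth (euler_series * E) n"
      by (simp add: fps_mult_nth E_def euler_series_def atLeast0AtMost sum_distrib_left mult_ac)
    also have "\<dots> = (1 - var_q) ^ n * ?W * fps_nth (E * euler_series) n"
      by (simp only: qpoch_eq_prod_sum mult.commute[of E])
    finally have W: "?W = (1 - var_q) ^ n * ?W * fps_nth (E * euler_series) n" .
    have "((1 - var_q) ^ n * ?W) * inverse (?Q n) = 1"
      using qpoch_var_q_inverse[of n] by (simp only: qpoch_eq_prod_sum)
    \<comment> \<open>The q-factorial divides a unit, so it is nonzero and can be cancelled.\<close>
    then have "?W \<noteq> 0"
      by (metis mult_zero_left mult_zero_right zero_neq_one)
    with W have "(1 - var_q) ^ n * fps_nth (E * euler_series) n = 1"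
      by (simp add: mult_ac del: sum.lessThan_Suc)
    then have "(c * (1 - var_q)) ^ n * fps_nth (E * euler_series) n = c ^ n"
      by (simp add: power_mult_distrib mult.assoc)
    then show ?thesis by (simp add: c(1))
  qed
  have EF: "E * euler_series * F = 1"
  proof (rule fps_ext)
    fix n show "fps_nth (E * euler_series * F) n = fps_nth 1 n"
    proof -
      have "E * euler_series * F = E * euler_series - fps_const c * (fps_X * (E * euler_series))"
        by (simp add: F_def algebra_simps)
      then have "fps_nth (E * euler_series * F) n =
          fps_nth (E * euler_series) n - c * fps_nth (fps_X * (E * euler_series)) n"
        by (simp only: fps_sub_nth fps_mult_left_const_nth)
      then show ?thesis
        by (cases n) (simp_all add: nth del: fps_mult_nth_0)
    qed
  qed
  have "E * euler_series = E * euler_series * (F * inverse F)"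
    unfolding fps_inverse_def[of F] by (subst fps_right_inverse) (simp_all add: F_def)
  also have "\<dots> = inverse F"
    unfolding mult.assoc[symmetric] EF by (rule mult_1_left)
  finally have "E * euler_series = inverse F" .
  then show ?thesis
    unfolding E_def F_def c(2) .
qed

lemma desarr_series_eq:
  "inverse (1 - fps_const (1 / (1 - var_q)) * fps_X) * qpoch_inf fps_X (fps_const var_q) =
     Abs_fps (\<lambda>m. desarr_poly var_q m * inverse (qpoch var_q var_q m))"
  by (simp add: mult.assoc mult.commute[of euler_series] qpoch_inf_mult_euler_series
      flip: desarr_series_mult_euler_series)

text \<open>One \<open>var_Y0\<close> goes into each factor, which clears the inverse and yields the
  product in the closed form of \<open>signed_pascal\<close>.\<close>

lemma qpoch_mult_var_Y0_power:
  "qpoch (- var_q * inverse var_Y0 * var_Y1 * var_Z) var_q s * var_Y0 ^ s =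
     (\<Prod>i<s. var_Y0 + var_q ^ Suc i * var_Y1 * var_Z)"
proof -
  have Y0: "inverse var_Y0 * var_Y0 = 1"
    by (rule inverse_mult_eq_1) (simp add: var_Y0_def)
  have "(1 - - var_q * inverse var_Y0 * var_Y1 * var_Z * var_q ^ i) * var_Y0 =
      var_Y0 + var_q ^ Suc i * var_Y1 * var_Z" for i
  proof -
    have "(1 - - var_q * inverse var_Y0 * var_Y1 * var_Z * var_q ^ i) * var_Y0 =
        var_Y0 + var_q ^ Suc i * var_Y1 * var_Z * (inverse var_Y0 * var_Y0)"
      by (simp add: algebra_simps)
    then show ?thesis by (simp only: Y0 mult_1_right)
  qed
  then have "(\<Prod>i<s. (1 - - var_q * inverse var_Y0 * var_Y1 * var_Z * var_q ^ i) * var_Y0) =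
      (\<Prod>i<s. var_Y0 + var_q ^ Suc i * var_Y1 * var_Z)"
    by (intro prod.cong refl)
  then show ?thesis
    unfolding qpoch_def prod.distrib by (simp only: prod_constant card_lessThan)
qed

theorem theorem1p2:
  fixes B :: "nat \<Rightarrow> qseries"
  assumes B_def: "Abs_fps (\<lambda>n. B n / (qpoch (- var_Z * var_q) var_q n * qpoch var_q var_q n)) =
    inverse (1 - fps_const (1 / (1 - var_q)) * fps_X) *
    qpoch_inf fps_X (fps_const var_q) *
    Abs_fps (\<lambda>n. qpoch (- var_q * inverse var_Y0 * var_Y1 * var_Z) var_q n * var_Y0 ^ n /
                  (qpoch (- var_Z * var_q) var_q n * qpoch var_q var_q n))"
  shows "\<forall>n. B n = (\<Sum>w\<in>signed_perms n.
    var_q ^ coxeter_length w * var_Y0 ^ pix_plus w * var_Y1 ^ pix_minus w * var_Z ^ neg w)"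
proof
  fix n
  let ?Q = "\<lambda>n. qpoch var_q var_q n" and ?R = "\<lambda>n. qpoch (- var_Z * var_q) var_q n"
    and ?Y = "\<lambda>s. \<Prod>i<s. var_Y0 + var_q ^ Suc i * var_Y1 * var_Z"
  have R: "?R n * inverse (?R n) = 1" for n
    by (rule qpoch_inverse)
  have divide: "c / (?R n * ?Q n) = c * (inverse (?R n) * inverse (?Q n))" for c n
    using qpoch_constant_term[of "- var_Z" n] qpoch_constant_term[of 1 n]
    by (simp add: fps_divide_unit fps_inverse_mult)
  have "B n = B n * (?R n * inverse (?R n)) * (?Q n * inverse (?Q n))"
    by (simp only: R qpoch_var_q_inverse mult_1_right)
  also have "\<dots> = ?R n * ?Q n * (B n / (?R n * ?Q n))"
    unfolding divide by (simp only: mult_ac)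
  also have "B n / (?R n * ?Q n) = fps_nth (Abs_fps (\<lambda>n. ?Y n / (?R n * ?Q n)) *
      Abs_fps (\<lambda>m. desarr_poly var_q m * inverse (?Q m))) n"
    using arg_cong[OF B_def, of "\<lambda>F. fps_nth F n"]
    by (simp only: desarr_series_eq qpoch_mult_var_Y0_power fps_nth_Abs_fps
        mult.commute[of "Abs_fps (\<lambda>m. desarr_poly var_q m * inverse (?Q m))"])
  also have "?R n * ?Q n * \<dots> = (\<Sum>s\<le>n. ?R n * ?Q n *
      (?Y s * (inverse (?R s) * inverse (?Q s)) * (desarr_poly var_q (n - s) * inverse (?Q (n - s)))))"
    by (simp only: fps_mult_nth fps_nth_Abs_fps sum_distrib_left divide atLeast0AtMost)
  also have "\<dots> = (\<Sum>s\<le>n. signed_pascal var_q var_Y0 var_Y1 var_Z s (n - s) * desarr_poly var_q (n - s))"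
  proof (intro sum.cong refl)
    fix s assume "s \<in> {..n}"
    then have s: "s + (n - s) = n" by simp
    \<comment> \<open>The quotient of \<open>?R n\<close> by \<open>?R s\<close> is the shifted
      factorial that occurs in the closed form of \<open>signed_pascal\<close>.\<close>
    have "?R n = ?R s * qpoch (- var_Z * var_q ^ Suc s) var_q (n - s)"
      using qpoch_add[of "- var_Z * var_q" var_q s "n - s"] unfolding s
      by (simp only: power_Suc mult.assoc)
    then have "?R n * ?Q n *
      (?Y s * (inverse (?R s) * inverse (?Q s)) * (desarr_poly var_q (n - s) * inverse (?Q (n - s)))) =
      (?R s * inverse (?R s)) * (?Q n * qpoch (- var_Z * var_q ^ Suc s) var_q (n - s) * ?Y s *
        (inverse (?Q s) * inverse (?Q (n - s))) * desarr_poly var_q (n - s))"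
      by (simp only: mult_ac)
    also have "\<dots> = signed_pascal var_q var_Y0 var_Y1 var_Z s (n - s) * desarr_poly var_q (n - s)"
      unfolding R signed_pascal_var_q s mult_1_left ..
    finally show "?R n * ?Q n *
      (?Y s * (inverse (?R s) * inverse (?Q s)) * (desarr_poly var_q (n - s) * inverse (?Q (n - s)))) =
      signed_pascal var_q var_Y0 var_Y1 var_Z s (n - s) * desarr_poly var_q (n - s)" .
  qed
  also have "\<dots> = (\<Sum>w\<in>signed_perms n.
    var_q ^ coxeter_length w * var_Y0 ^ pix_plus w * var_Y1 ^ pix_minus w * var_Z ^ neg w)"
    by (rule sum_signed_perms[symmetric])
  finally show "B n = (\<Sum>w\<in>signed_perms n.
    var_q ^ coxeter_length w * var_Y0 ^ pix_plus w * var_Y1 ^ pix_minus w * var_Z ^ neg w)" .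
qed

end
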